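(* Let $p\ge 1$ be an integer, let $\operatorname{dom} f\subseteq\mathbb{E}$ be open and convex, and let $f:\operatorname{dom} f\to\mathbb{R}$ be convex and $p$ times continuously differentiable. Assume that the $p$th derivative of $f$ is Lipschitz continuous on $\operatorname{dom} f$ with constant $L_p=L_p(f)\in(0,+\infty)$, and that $f$ is uniformly convex of degree $p+1$ with constant $\sigma_{p+1}(f)>0$, i.e. $\langle\nabla f(y)-\nabla f(x),y-x\rangle\ge\sigma_{p+1}(f)\|y-x\|^{p+1}$ for all $x,y\in\operatorname{dom} f$. Put $\gamma_p(f)=\sigma_{p+1}(f)/L_p(f)$ and, for $\alpha\ge 0$, $$\beta_p(f,\alpha)=\frac{(p!\,\gamma_p(f))^{1/p}}{(1+\alpha)^{1/p}+(p!\,\gamma_p(f))^{1/p}}.$$ Then for every $\alpha\ge 0$, every $\beta$ with $0\le\beta\le\beta_p(f,\alpha)$, and all $x,y\in\operatorname{dom} f$, $$\langle\nabla f(y)-\nabla f(x),y-x\rangle\ \ge\ \sum_{k=2}^p\frac{\beta^{k-1}}{(k-1)!}D^kf(x)[y-x]^k+\frac{\alpha L_p\beta^p}{p!}\|y-x\|^{p+1},$$ $$f(y)\ \ge\ f(x)+\langle\nabla f(x),y-x\rangle+\sum_{k=2}^p\frac{\beta^{k-1}}{k!}D^kf(x)[y-x]^k+\frac{\alpha L_p\beta^p}{(p+1)!}\|y-x\|^{p+1}.$$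
   Context: $\mathbb{E}$ is a finite-dimensional real vector space with dual $\mathbb{E}^*$; $\langle s,x\rangle$ is the value of $s\in\mathbb{E}^*$ at $x\in\mathbb{E}$. Fix a self-adjoint positive-definite operator $B:\mathbb{E}\to\mathbb{E}^*$ and set $\|x\|=\langle Bx,x\rangle^{1/2}$. $D^kf(x)[h_1,\dots,h_k]$ is the $k$th directional derivative of $f$ at $x$ (a symmetric $k$-linear form), and $D^kf(x)[h]^k$ denotes its value when all directions equal $h$. The norm of a symmetric $p$-linear form is $\|D^pf(x)\|=\max\{D^pf(x)[h_1,\dots,h_p]:\|h_i\|\le 1\}$. The Lipschitz condition is $\|D^pf(x)-D^pf(y)\|\le L_p\|x-y\|$ for all $x,y\in\operatorname{dom} f$. For $p=1$ the sums over $k=2,\dots,p$ are empty. *)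

theory Defs
  imports "HOL-Analysis.Analysis"
begin

text \<open>
  The vector space is a type \<open>'a\<close> of class \<open>euclidean_space\<close>, which supplies only finite
  dimension and the topology; its built-in norm and inner product play no role. The dual space
  is \<open>'a \<Rightarrow>\<^sub>L real\<close>, so that the value of \<open>s\<close> at \<open>x\<close> is \<open>blinfun_apply s x\<close>, and the norm is the
  one induced by an operator \<open>B\<close> from the space to its dual.
\<close>

definition self_adjoint :: "('a::euclidean_space \<Rightarrow>\<^sub>L 'a \<Rightarrow>\<^sub>L real) \<Rightarrow> bool" where
  "self_adjoint B \<longleftrightarrow>
     (\<forall>x y. blinfun_apply (blinfun_apply B x) y = blinfun_apply (blinfun_apply B y) x)"

definition positive_definite :: "('a::euclidean_space \<Rightarrow>\<^sub>L 'a \<Rightarrow>\<^sub>L real) \<Rightarrow> bool" where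
  "positive_definite B \<longleftrightarrow> (\<forall>x. x \<noteq> 0 \<longrightarrow> blinfun_apply (blinfun_apply B x) x > 0)"

definition Bnorm :: "('a::euclidean_space \<Rightarrow>\<^sub>L 'a \<Rightarrow>\<^sub>L real) \<Rightarrow> 'a \<Rightarrow> real" where
  "Bnorm B x = sqrt (blinfun_apply (blinfun_apply B x) x)"

text \<open>The gradient as an element of the dual space (meaningful where \<open>f\<close> is differentiable).\<close>

definition grad :: "('a::euclidean_space \<Rightarrow> real) \<Rightarrow> 'a \<Rightarrow> ('a \<Rightarrow>\<^sub>L real)" where
  "grad f x = Blinfun (frechet_derivative f (at x))"

text \<open>
  \<open>Dk f x [h\<^sub>1, \<dots>, h\<^sub>k]\<close> is the \<open>k\<close>th directional derivative of \<open>f\<close> at \<open>x\<close> along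
  \<open>h\<^sub>1, \<dots>, h\<^sub>k\<close>; its order is the length of the list. At a point of an open set it depends only
  on the values of \<open>f\<close> on that set.
\<close>

fun Dk :: "('a::euclidean_space \<Rightarrow> real) \<Rightarrow> 'a \<Rightarrow> 'a list \<Rightarrow> real" where
  "Dk f x [] = f x"
| "Dk f x (h # hs) = Dk (\<lambda>y. frechet_derivative f (at y) h) x hs"

text \<open>
  For open \<open>S\<close>, \<open>k\<close> times continuous differentiability on \<open>S\<close>. Since the dimension is finite,
  the derivative map is \<open>C\<^sup>k\<close> iff its evaluation at every fixed direction is.
\<close>

fun C_on :: "nat \<Rightarrow> 'a::euclidean_space set \<Rightarrow> ('a \<Rightarrow> real) \<Rightarrow> bool" where
  "C_on 0 S f \<longleftrightarrow> continuous_on S f"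
| "C_on (Suc k) S f \<longleftrightarrow>
     (\<forall>x\<in>S. f differentiable (at x)) \<and> (\<forall>h. C_on k S (\<lambda>y. frechet_derivative f (at y) h))"

text \<open>
  The norm of a \<open>p\<close>-linear form, whose \<open>p\<close> arguments are passed as a list. For a multilinear form
  the set below is compact and nonempty, so the supremum is a maximum.
\<close>

definition form_norm ::
  "('a::euclidean_space \<Rightarrow>\<^sub>L 'a \<Rightarrow>\<^sub>L real) \<Rightarrow> nat \<Rightarrow> ('a list \<Rightarrow> real) \<Rightarrow> real" where
  "form_norm B p A = Sup {A hs |hs. length hs = p \<and> (\<forall>h\<in>set hs. Bnorm B h \<le> 1)}"

definition lipschitz_pth_deriv ::
  "('a::euclidean_space \<Rightarrow>\<^sub>L 'a \<Rightarrow>\<^sub>L real) \<Rightarrow> nat \<Rightarrow> 'a set \<Rightarrow> ('a \<Rightarrow> real) \<Rightarrow> real \<Rightarrow> bool" where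
  "lipschitz_pth_deriv B p S f L \<longleftrightarrow>
     (\<forall>x\<in>S. \<forall>y\<in>S. form_norm B p (\<lambda>hs. Dk f x hs - Dk f y hs) \<le> L * Bnorm B (x - y))"

definition uniformly_convex_on ::
  "('a::euclidean_space \<Rightarrow>\<^sub>L 'a \<Rightarrow>\<^sub>L real) \<Rightarrow> nat \<Rightarrow> 'a set \<Rightarrow> ('a \<Rightarrow> real) \<Rightarrow> real \<Rightarrow> bool" where
  "uniformly_convex_on B q S f \<sigma> \<longleftrightarrow>
     (\<forall>x\<in>S. \<forall>y\<in>S. blinfun_apply (grad f y - grad f x) (y - x) \<ge> \<sigma> * Bnorm B (y - x) ^ q)"

text \<open>\<open>\<gamma>\<close> stands for the ratio of the uniform convexity constant to the Lipschitz constant.\<close>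

definition beta_max :: "nat \<Rightarrow> real \<Rightarrow> real \<Rightarrow> real" where
  "beta_max p \<gamma> \<alpha> =
     (fact p * \<gamma>) powr (1 / real p) /
     ((1 + \<alpha>) powr (1 / real p) + (fact p * \<gamma>) powr (1 / real p))"

end

theory Submission
  imports Defs
begin

text \<open>
  Write \<open>h = y - x\<close>, \<open>r = \<parallel>h\<parallel>\<close> and restrict everything to the segment
  \<open>x + t h\<close>, \<open>0 \<le> t \<le> 1\<close>. With \<open>\<phi>\<^sub>k(t) = D\<^sup>kf(x + t h)[h]\<^sup>k\<close> one has \<open>\<phi>\<^sub>k' = \<phi>\<^sub>k\<^sub>+\<^sub>1\<close> for
  \<open>k < p\<close>, and \<open>\<phi>\<^sub>1(t) = \<langle>\<nabla>f(x + t h), h\<rangle>\<close>. The increment of \<open>\<phi>\<^sub>1\<close> over \<open>[0, t]\<close> is split at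
  the intermediate point \<open>\<beta> t\<close>.

  On \<open>[0, \<beta> t]\<close> the Lipschitz condition gives \<open>\<phi>\<^sub>p(s) \<ge> \<phi>\<^sub>p(0) - L r\<^sup>p\<^sup>+\<^sup>1 s\<close>
  (\<open>lipschitz_pth_deriv_diagonal\<close>), and integrating this \<open>p - 1\<close> times
  (\<open>Taylor_lower_bound\<close>) bounds \<open>\<phi>\<^sub>1(\<beta> t) - \<phi>\<^sub>1(0)\<close> below by the sum of the derivative terms
  minus the error \<open>L r\<^sup>p\<^sup>+\<^sup>1 (\<beta> t)\<^sup>p / p!\<close>. On \<open>[\<beta> t, t]\<close>, whose ends differ by \<open>(1 - \<beta>) t h\<close>,
  uniform convexity gives \<open>\<phi>\<^sub>1(t) - \<phi>\<^sub>1(\<beta> t) \<ge> \<sigma> (1 - \<beta>)\<^sup>p t\<^sup>p r\<^sup>p\<^sup>+\<^sup>1\<close>. The bound on \<open>\<beta>\<close>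
  guarantees \<open>\<sigma> (1 - \<beta>)\<^sup>p \<ge> (1 + \<alpha>) L \<beta>\<^sup>p / p!\<close> (\<open>beta_max_trade_off\<close>), so that this gain pays
  for the Taylor error and leaves \<open>\<alpha> L \<beta>\<^sup>p t\<^sup>p r\<^sup>p\<^sup>+\<^sup>1 / p!\<close>.

  At \<open>t = 1\<close> this is the first inequality; integrated over \<open>t\<close> from \<open>0\<close> to \<open>1\<close> it is the second,
  each factor \<open>t\<^sup>k\<^sup>-\<^sup>1 / (k - 1)!\<close> turning into \<open>1 / k!\<close>. All integrations are carried out as
  comparisons of functions through their derivatives (\<open>le_if_deriv_le\<close>).
\<close>

section \<open>Multilinearity and boundedness of iterated derivatives\<close>

lemma frechet_derivative_cong_open:
  assumes "open S" "x \<in> S" "\<And>y. y \<in> S \<Longrightarrow> f y = g y"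
  shows "frechet_derivative f (at x) = frechet_derivative g (at x)"
proof -
  have "(f has_derivative D) (at x) \<longleftrightarrow> (g has_derivative D) (at x)" for D
    using has_derivative_transform_within_open[OF _ assms(1,2), of f D UNIV g]
      has_derivative_transform_within_open[OF _ assms(1,2), of g D UNIV f] assms(3) by auto
  then show ?thesis
    unfolding frechet_derivative_def by simp
qed

lemma Dk_cong_open:
  assumes "open S" "x \<in> S" "\<And>y. y \<in> S \<Longrightarrow> f y = g y"
  shows "Dk f x hs = Dk g x hs"
  using assms(3)
proof (induction hs arbitrary: f g)
  case Nil
  then show ?case using assms(2) by simp
next
  case (Cons h hs)
  have "frechet_derivative f (at y) h = frechet_derivative g (at y) h" if "y \<in> S" for y
    using frechet_derivative_cong_open[OF assms(1) that Cons.prems] by simp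
  then show ?case unfolding Dk.simps by (rule Cons.IH)
qed

text \<open>
  Linearity in the function. It is the source of all linearity in the directions: a
  directional derivative along \<open>\<Sum> c\<^sub>i h\<^sub>i\<close> is a linear combination of functions, and the
  remaining differentiations pass through it.
\<close>

lemma Dk_linear_combination:
  assumes "open S" "x \<in> S" "\<And>i. i \<in> I \<Longrightarrow> C_on (length hs) S (F i)"
  shows "Dk (\<lambda>y. \<Sum>i\<in>I. c i * F i y) x hs = (\<Sum>i\<in>I. c i * Dk (F i) x hs)"
  using assms(3)
proof (induction hs arbitrary: F)
  case Nil
  then show ?case by simp
next
  case (Cons h hs)
  have *: "frechet_derivative (\<lambda>y. \<Sum>i\<in>I. c i * F i y) (at y) h
      = (\<Sum>i\<in>I. c i * frechet_derivative (F i) (at y) h)" if "y \<in> S" for y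
  proof -
    have "(F i has_derivative frechet_derivative (F i) (at y)) (at y)" if "i \<in> I" for i
      using Cons.prems[OF that] \<open>y \<in> S\<close> by (simp add: frechet_derivative_works)
    then have "((\<lambda>y. \<Sum>i\<in>I. c i * F i y) has_derivative
        (\<lambda>h. \<Sum>i\<in>I. c i * frechet_derivative (F i) (at y) h)) (at y)"
      by (intro has_derivative_sum has_derivative_mult_right) auto
    from frechet_derivative_at[OF this, symmetric] show ?thesis
      by (rule fun_cong)
  qed
  have "Dk (\<lambda>y. \<Sum>i\<in>I. c i * F i y) x (h # hs)
      = Dk (\<lambda>y. \<Sum>i\<in>I. c i * frechet_derivative (F i) (at y) h) x hs"
    unfolding Dk.simps by (rule Dk_cong_open[OF assms(1,2)]) (rule *)
  also have "\<dots> = (\<Sum>i\<in>I. c i * Dk (\<lambda>y. frechet_derivative (F i) (at y) h) x hs)"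
    using Cons.prems by (intro Cons.IH) simp
  finally show ?case by simp
qed

lemma Dk_head_expand:
  assumes "open S" "x \<in> S" "C_on (Suc (length hs)) S f"
  shows "Dk f x (h # hs) = (\<Sum>b\<in>Basis. (h \<bullet> b) * Dk f x (b # hs))"
proof -
  have "frechet_derivative f (at y) h = (\<Sum>b\<in>Basis. (h \<bullet> b) * frechet_derivative f (at y) b)"
    if "y \<in> S" for y
  proof -
    interpret linear "frechet_derivative f (at y)"
      using assms(3) that by (auto intro: linear_frechet_derivative)
    have "frechet_derivative f (at y) h = frechet_derivative f (at y) (\<Sum>b\<in>Basis. (h \<bullet> b) *\<^sub>R b)"
      by (simp add: euclidean_representation)
    then show ?thesis by (simp add: sum scale)
  qed
  then have "Dk f x (h # hs)
      = Dk (\<lambda>y. \<Sum>b\<in>Basis. (h \<bullet> b) * frechet_derivative f (at y) b) x hs"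
    unfolding Dk.simps by (intro Dk_cong_open[OF assms(1,2)])
  also have "\<dots> = (\<Sum>b\<in>Basis. (h \<bullet> b) * Dk f x (b # hs))"
    using assms(3) by (simp add: Dk_linear_combination[OF assms(1,2)])
  finally show ?thesis .
qed

lemma Dk_scale_args:
  assumes "open S" "x \<in> S" "C_on (length hs) S f"
  shows "Dk f x (map ((*\<^sub>R) c) hs) = c ^ length hs * Dk f x hs"
  using assms(3)
proof (induction hs arbitrary: f)
  case Nil
  then show ?case by simp
next
  case (Cons h hs)
  have "Dk f x (map ((*\<^sub>R) c) (h # hs)) = c * Dk f x (h # map ((*\<^sub>R) c) hs)"
    using Cons.prems Dk_head_expand[OF assms(1,2), of "map ((*\<^sub>R) c) hs" f "c *\<^sub>R h"]
      Dk_head_expand[OF assms(1,2), of "map ((*\<^sub>R) c) hs" f h]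
    by (simp del: Dk.simps C_on.simps add: sum_distrib_left mult.assoc)
  also have "\<dots> = c * (c ^ length hs * Dk f x (h # hs))"
    using Cons by simp
  finally show ?case by simp
qed

text \<open>
  A real supremum says nothing about the elements of a set that is unbounded above, so the Lipschitz
  condition, which bounds a \<open>form_norm\<close>, becomes usable only once the values of the form on
  the unit ball are known to be bounded. Expanding the directions one after the other in the
  basis reduces this to finitely many numbers.
\<close>

lemma Dk_bounded:
  assumes "open S" "x \<in> S" "C_on k S f"
  shows "\<exists>M. \<forall>hs. length hs = k \<longrightarrow> (\<forall>h\<in>set hs. norm h \<le> R) \<longrightarrow> \<bar>Dk f x hs\<bar> \<le> M"
  using assms(3)
proof (induction k arbitrary: f)
  case 0
  then show ?case by auto
next
  case (Suc k)
  have "\<exists>M. \<forall>hs. length hs = k \<longrightarrow> (\<forall>h\<in>set hs. norm h \<le> R) \<longrightarrow> \<bar>Dk f x (b # hs)\<bar> \<le> M" for b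
    using Suc.IH[of "\<lambda>y. frechet_derivative f (at y) b"] Suc.prems by simp
  then obtain M where M: "\<And>b hs. length hs = k \<Longrightarrow> (\<forall>h\<in>set hs. norm h \<le> R)
      \<Longrightarrow> \<bar>Dk f x (b # hs)\<bar> \<le> M b"
    by metis
  show ?case
  proof (intro exI allI impI)
    fix hs :: "'a list"
    assume hs: "length hs = Suc k" "\<forall>h\<in>set hs. norm h \<le> R"
    then obtain h hs' where eq: "hs = h # hs'" and len: "length hs' = k"
      by (auto simp: length_Suc_conv)
    have "\<bar>Dk f x (h # hs')\<bar> \<le> (\<Sum>b\<in>Basis. \<bar>h \<bullet> b\<bar> * \<bar>Dk f x (b # hs')\<bar>)"
      unfolding Dk_head_expand[OF assms(1,2), of hs' f h, unfolded len, OF Suc.prems]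
      by (simp only: abs_mult[symmetric] sum_abs)
    also have "\<dots> \<le> (\<Sum>b\<in>Basis. R * M b)"
    proof (intro sum_mono mult_mono)
      fix b :: 'a
      assume "b \<in> Basis"
      show "\<bar>h \<bullet> b\<bar> \<le> R"
        using Basis_le_norm[OF \<open>b \<in> Basis\<close>, of h] hs eq by fastforce
      then show "0 \<le> R" by linarith
      show "\<bar>Dk f x (b # hs')\<bar> \<le> M b"
        using M len hs eq by simp
    qed simp
    finally show "\<bar>Dk f x hs\<bar> \<le> (\<Sum>b\<in>Basis. R * M b)"
      using eq by simp
  qed
qed

section \<open>The norm induced by a positive definite operator\<close>

lemma Bnorm_nonneg:
  assumes "positive_definite B"
  shows "Bnorm B x \<ge> 0"
  using assms by (cases "x = 0") (auto simp: Bnorm_def positive_definite_def less_imp_le)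

lemma Bnorm_pos:
  assumes "positive_definite B" "x \<noteq> 0"
  shows "Bnorm B x > 0"
  using assms by (auto simp: Bnorm_def positive_definite_def)

lemma Bnorm_scaleR: "Bnorm B (c *\<^sub>R x) = \<bar>c\<bar> * Bnorm B x"
  by (simp add: Bnorm_def blinfun.scaleR_left blinfun.scaleR_right mult.assoc[symmetric]
      real_sqrt_mult)

text \<open>
  By homogeneity it suffices to compare on the Euclidean unit sphere, where \<open>Bnorm B\<close> attains a
  positive minimum.
\<close>

lemma norm_le_Bnorm:
  fixes B :: "'a::euclidean_space \<Rightarrow>\<^sub>L 'a \<Rightarrow>\<^sub>L real"
  assumes "positive_definite B"
  obtains R where "\<And>x. norm x \<le> R * Bnorm B x"
proof -
  have "continuous_on (sphere (0::'a) 1) (Bnorm B)"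
    unfolding Bnorm_def by (intro continuous_intros)
  moreover have "sphere (0::'a) 1 \<noteq> {}"
    by simp
  ultimately obtain u where u: "u \<in> sphere 0 1" "\<And>v. v \<in> sphere 0 1 \<Longrightarrow> Bnorm B u \<le> Bnorm B v"
    using continuous_attains_inf[OF compact_sphere] by metis
  have pos: "Bnorm B u > 0"
    using u(1) by (intro Bnorm_pos[OF assms]) auto
  have "norm x \<le> (1 / Bnorm B u) * Bnorm B x" for x
  proof (cases "x = 0")
    case True
    then show ?thesis by (simp add: Bnorm_def)
  next
    case False
    then have "Bnorm B u \<le> Bnorm B ((1 / norm x) *\<^sub>R x)"
      by (intro u(2)) simp
    then show ?thesis
      using False pos unfolding Bnorm_scaleR by (simp add: field_simps)
  qed
  then show thesis by (rule that)
qed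

section \<open>The Lipschitz condition along one direction\<close>

lemma le_form_norm_diff:
  assumes "positive_definite B" "open S" "x \<in> S" "y \<in> S" "C_on p S f"
    and hs: "length hs = p" "\<forall>h\<in>set hs. Bnorm B h \<le> 1"
  shows "Dk f x hs - Dk f y hs \<le> form_norm B p (\<lambda>hs. Dk f x hs - Dk f y hs)"
proof -
  obtain R where R: "\<And>x. norm x \<le> R * Bnorm B x"
    using norm_le_Bnorm[OF assms(1)] by blast
  have ball: "norm h \<le> \<bar>R\<bar>" if "Bnorm B h \<le> 1" for h
  proof -
    have "R * Bnorm B h \<le> \<bar>R\<bar> * Bnorm B h"
      by (intro mult_right_mono Bnorm_nonneg[OF assms(1)]) simp
    also have "\<dots> \<le> \<bar>R\<bar>"
      using that by (simp add: mult_left_le)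
    finally show ?thesis using R[of h] by linarith
  qed
  obtain M N where M: "\<And>hs. length hs = p \<Longrightarrow> (\<forall>h\<in>set hs. norm h \<le> \<bar>R\<bar>) \<Longrightarrow> \<bar>Dk f x hs\<bar> \<le> M"
    and N: "\<And>hs. length hs = p \<Longrightarrow> (\<forall>h\<in>set hs. norm h \<le> \<bar>R\<bar>) \<Longrightarrow> \<bar>Dk f y hs\<bar> \<le> N"
    using Dk_bounded[OF assms(2,3,5), of "\<bar>R\<bar>"] Dk_bounded[OF assms(2,4,5), of "\<bar>R\<bar>"] by metis
  have "Dk f x ks - Dk f y ks \<le> M + N" if "length ks = p" "\<forall>h\<in>set ks. Bnorm B h \<le> 1" for ks
    using M[OF that(1)] N[OF that(1)] that(2) ball by fastforce
  then show ?thesis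
    unfolding form_norm_def using hs by (intro cSup_upper bdd_aboveI[of _ "M + N"]) auto
qed

text \<open>
  The form norm controls arguments in the unit ball only; the general direction \<open>h\<close> is reached by
  \<open>p\<close>-homogeneity.
\<close>

lemma lipschitz_pth_deriv_diagonal:
  assumes "positive_definite B" "open S" "x \<in> S" "y \<in> S" "C_on p S f"
    and lip: "lipschitz_pth_deriv B p S f L"
  shows "Dk f x (replicate p h) - Dk f y (replicate p h) \<le> L * Bnorm B (x - y) * Bnorm B h ^ p"
proof -
  define r where "r = Bnorm B h"
  define u where "u = (1 / r) *\<^sub>R h"
  have r: "r \<ge> 0"
    unfolding r_def by (rule Bnorm_nonneg[OF assms(1)])
  \<comment> \<open>For \<open>h = 0\<close> this holds because then \<open>r = 0\<close> and, as \<open>1 / 0 = 0\<close>, also \<open>u = 0\<close>.\<close>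
  have h: "h = r *\<^sub>R u"
    using Bnorm_pos[OF assms(1), of h] by (cases "h = 0") (auto simp: u_def r_def)
  have u: "Bnorm B u \<le> 1"
    using r by (simp add: u_def Bnorm_scaleR flip: r_def)
  have scale: "Dk f z (replicate p h) = r ^ p * Dk f z (replicate p u)" if "z \<in> S" for z
    using Dk_scale_args[OF assms(2) that, of "replicate p u" f r] assms(5) by (simp add: h)
  have "Dk f x (replicate p u) - Dk f y (replicate p u)
      \<le> form_norm B p (\<lambda>hs. Dk f x hs - Dk f y hs)"
    using u by (intro le_form_norm_diff[OF assms(1-5)]) auto
  also have "\<dots> \<le> L * Bnorm B (x - y)"
    using lip assms(3,4) by (simp add: lipschitz_pth_deriv_def)
  finally have "r ^ p * (Dk f x (replicate p u) - Dk f y (replicate p u))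
      \<le> r ^ p * (L * Bnorm B (x - y))"
    using r by (intro mult_left_mono) auto
  then show ?thesis
    using scale assms(3,4) by (simp add: algebra_simps flip: r_def)
qed

section \<open>Restriction to a line\<close>

lemma Dk_along_line_has_derivative:
  assumes "C_on p S f" "k < p" "x + t *\<^sub>R h \<in> S"
  shows "((\<lambda>s. Dk f (x + s *\<^sub>R h) (replicate k h)) has_real_derivative
      Dk f (x + t *\<^sub>R h) (replicate (Suc k) h)) (at t)"
  using assms(1,2)
proof (induction k arbitrary: f p)
  case 0
  let ?D = "frechet_derivative f (at (x + t *\<^sub>R h))"
  have "(f has_derivative ?D) (at (x + t *\<^sub>R h))"
    using 0 assms(3) by (cases p) (auto simp: frechet_derivative_works)
  moreover have "((\<lambda>s. x + s *\<^sub>R h) has_derivative (\<lambda>s. s *\<^sub>R h)) (at t)"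
    by (auto intro!: derivative_eq_intros)
  ultimately have "((\<lambda>s. f (x + s *\<^sub>R h)) has_derivative (\<lambda>s. ?D (s *\<^sub>R h))) (at t)"
    using has_derivative_compose by fastforce
  moreover have "(\<lambda>s. ?D (s *\<^sub>R h)) = (*) (?D h)"
    using has_derivative_linear[OF \<open>(f has_derivative ?D) _\<close>]
    by (auto simp: linear_cmul mult.commute)
  ultimately show ?case
    by (simp add: has_field_derivative_def)
next
  case (Suc k)
  then obtain q where p: "p = Suc q" "k < q"
    by (cases p) auto
  then show ?case
    using Suc.IH[of q "\<lambda>y. frechet_derivative f (at y) h"] Suc.prems by simp
qed

lemma grad_apply:
  assumes "f differentiable (at x)"
  shows "blinfun_apply (grad f x) h = frechet_derivative f (at x) h"
  unfolding grad_def using assms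
  by (simp add: bounded_linear_Blinfun_apply frechet_derivative_works has_derivative_bounded_linear)

section \<open>One-dimensional Taylor estimate\<close>

lemma le_if_deriv_le:
  fixes u v :: "real \<Rightarrow> real"
  assumes "\<And>s. 0 \<le> s \<Longrightarrow> s \<le> 1 \<Longrightarrow> (u has_real_derivative u' s) (at s)"
    and "\<And>s. 0 \<le> s \<Longrightarrow> s \<le> 1 \<Longrightarrow> (v has_real_derivative v' s) (at s)"
    and "\<And>s. 0 \<le> s \<Longrightarrow> s \<le> 1 \<Longrightarrow> u' s \<le> v' s"
    and "u 0 \<le> v 0" "0 \<le> t" "t \<le> 1"
  shows "u t \<le> v t"
proof -
  have "v 0 - u 0 \<le> v t - u t"
  proof (rule DERIV_nonneg_imp_nondecreasing[OF assms(5)])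
    fix s
    assume "0 \<le> s" "s \<le> t"
    then show "\<exists>d. ((\<lambda>s. v s - u s) has_real_derivative d) (at s) \<and> 0 \<le> d"
      using assms(1,2,3)[of s] assms(6)
      by (intro exI[of _ "v' s - u' s"]) (auto intro!: derivative_intros)
  qed
  then show ?thesis using assms(4) by linarith
qed

lemma power_div_fact_deriv:
  "((\<lambda>s::real. s ^ Suc k / fact (Suc k)) has_real_derivative s ^ k / fact k) (at s)"
proof -
  have "((\<lambda>s::real. s ^ Suc k / fact (Suc k)) has_real_derivative
      real (Suc k) * s ^ k / fact (Suc k)) (at s)"
    by (auto intro!: derivative_eq_intros simp del: fact_Suc power_Suc)
  moreover have "real (Suc k) * s ^ k / fact (Suc k) = s ^ k / fact k"
    by (simp add: field_simps del: of_nat_Suc)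
  ultimately show ?thesis by simp
qed

text \<open>
  A one-sided Lipschitz bound on the last function of a chain of derivatives, integrated \<open>m\<close> times.
  The induction peels off the first function of the chain: the bound for
  \<open>\<phi> 1, \<dots>, \<phi> m\<close> compares the derivatives of the two sides of the bound for \<open>\<phi> 0\<close>.
\<close>

lemma Taylor_lower_bound:
  fixes \<phi> :: "nat \<Rightarrow> real \<Rightarrow> real"
  assumes "\<And>k s. k < m \<Longrightarrow> 0 \<le> s \<Longrightarrow> s \<le> 1 \<Longrightarrow> (\<phi> k has_real_derivative \<phi> (Suc k) s) (at s)"
    and "\<And>s. 0 \<le> s \<Longrightarrow> s \<le> 1 \<Longrightarrow> \<phi> m 0 - C * s \<le> \<phi> m s"
    and "0 \<le> t" "t \<le> 1"
  shows "(\<Sum>k\<le>m. t ^ k / fact k * \<phi> k 0) - C * (t ^ Suc m / fact (Suc m)) \<le> \<phi> 0 t"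
  using assms
proof (induction m arbitrary: \<phi> t)
  case 0
  then show ?case by simp
next
  case (Suc m)
  let ?T = "\<lambda>s. \<phi> 0 0 + (\<Sum>k\<le>m. s ^ Suc k / fact (Suc k) * \<phi> (Suc k) 0)
      - C * (s ^ Suc (Suc m) / fact (Suc (Suc m)))"
  let ?T' = "\<lambda>s. (\<Sum>k\<le>m. s ^ k / fact k * \<phi> (Suc k) 0) - C * (s ^ Suc m / fact (Suc m))"
  have "?T t \<le> \<phi> 0 t"
  proof (rule le_if_deriv_le[where u = ?T and v = "\<phi> 0"])
    fix s :: real
    assume s: "0 \<le> s" "s \<le> 1"
    have "(?T has_real_derivative 0 + (\<Sum>k\<le>m. s ^ k / fact k * \<phi> (Suc k) 0)
        - C * (s ^ Suc m / fact (Suc m))) (at s)"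
      by (intro DERIV_diff DERIV_add DERIV_const DERIV_sum DERIV_cmult DERIV_cmult_right
          power_div_fact_deriv)
    then show "(?T has_real_derivative ?T' s) (at s)" by simp
    show "(\<phi> 0 has_real_derivative \<phi> (Suc 0) s) (at s)"
      using Suc.prems(1) s by blast
    show "?T' s \<le> \<phi> (Suc 0) s"
      using Suc.IH[of "\<lambda>k. \<phi> (Suc k)" s] Suc.prems(1,2) s by simp
  qed (use Suc.prems in auto)
  then show ?case
    by (simp add: sum.atMost_Suc_shift del: fact_Suc power_Suc sum.atMost_Suc)
qed

section \<open>The lower bounds\<close>

text \<open>
  With \<open>a = (p! \<gamma>)\<^sup>1\<^sup>/\<^sup>p\<close> and \<open>b = (1 + \<alpha>)\<^sup>1\<^sup>/\<^sup>p\<close>, the hypothesis \<open>\<beta> \<le> a / (b + a)\<close> reads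
  \<open>b \<beta> \<le> a (1 - \<beta>)\<close>; raise this to the power \<open>p\<close>.
\<close>

lemma beta_max_trade_off:
  fixes \<gamma> \<alpha> \<beta> :: real
  assumes "p \<ge> 1" "\<gamma> > 0" "\<alpha> \<ge> 0" "0 \<le> \<beta>" "\<beta> \<le> beta_max p \<gamma> \<alpha>"
  shows "\<beta> < 1" and "(1 + \<alpha>) * \<beta> ^ p \<le> fact p * \<gamma> * (1 - \<beta>) ^ p"
proof -
  define a where "a = (fact p * \<gamma>) powr (1 / real p)"
  define b where "b = (1 + \<alpha>) powr (1 / real p)"
  have pos: "a > 0" "b > 0"
    using assms(2,3) by (auto simp: a_def b_def)
  have pow: "a ^ p = fact p * \<gamma>" "b ^ p = 1 + \<alpha>"
    using assms(1-3) pos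
    by (auto simp: a_def b_def powr_powr powr_realpow[symmetric])
  have le: "\<beta> \<le> a / (b + a)"
    using assms(5) by (simp add: beta_max_def a_def b_def)
  also have "\<dots> < 1"
    using pos by simp
  finally show "\<beta> < 1" .
  have "b * \<beta> \<le> a * (1 - \<beta>)"
    using le pos by (simp add: field_simps)
  then have "(b * \<beta>) ^ p \<le> (a * (1 - \<beta>)) ^ p"
    using pos assms(4) by (intro power_mono) auto
  then show "(1 + \<alpha>) * \<beta> ^ p \<le> fact p * \<gamma> * (1 - \<beta>) ^ p"
    by (simp add: power_mult_distrib pow)
qed

theorem theorem1:
  fixes B :: "'a::euclidean_space \<Rightarrow>\<^sub>L 'a \<Rightarrow>\<^sub>L real"
    and S :: "'a set" and f :: "'a \<Rightarrow> real"
    and p :: nat and L \<sigma> \<alpha> \<beta> :: real and x y :: 'a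
  assumes "self_adjoint B" and "positive_definite B"
    and "p \<ge> 1"
    and "open S" and "convex S"
    and "convex_on S f" and "C_on p S f"
    and "L > 0" and "lipschitz_pth_deriv B p S f L"
    and "\<sigma> > 0" and "uniformly_convex_on B (p + 1) S f \<sigma>"
    and "\<alpha> \<ge> 0" and "0 \<le> \<beta>" and "\<beta> \<le> beta_max p (\<sigma> / L) \<alpha>"
    and "x \<in> S" and "y \<in> S"
  shows "blinfun_apply (grad f y - grad f x) (y - x) \<ge>
           (\<Sum>k=2..p. \<beta> ^ (k - 1) / fact (k - 1) * Dk f x (replicate k (y - x)))
           + \<alpha> * L * \<beta> ^ p / fact p * Bnorm B (y - x) ^ (p + 1)
       \<and> f y \<ge> f x + blinfun_apply (grad f x) (y - x)
           + (\<Sum>k=2..p. \<beta> ^ (k - 1) / fact k * Dk f x (replicate k (y - x)))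
           + \<alpha> * L * \<beta> ^ p / fact (p + 1) * Bnorm B (y - x) ^ (p + 1)"
proof -
  define h where "h = y - x"
  define r where "r = Bnorm B h"
  define \<phi> where "\<phi> = (\<lambda>k s. Dk f (x + s *\<^sub>R h) (replicate k h))"
  note pd = assms(2)
  have r: "r \<ge> 0"
    unfolding r_def by (rule Bnorm_nonneg[OF pd])
  have seg: "x + s *\<^sub>R h \<in> S" if "0 \<le> s" "s \<le> 1" for s
    using convexD_alt[OF assms(5,15,16) that] by (simp add: h_def algebra_simps)
  have deriv: "(\<phi> k has_real_derivative \<phi> (Suc k) s) (at s)"
    if "k < p" "0 \<le> s" "s \<le> 1" for k s
    unfolding \<phi>_def by (rule Dk_along_line_has_derivative[OF assms(7) that(1) seg[OF that(2,3)]])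
  have grad: "blinfun_apply (grad f (x + s *\<^sub>R h)) h = \<phi> 1 s" if "0 \<le> s" "s \<le> 1" for s
    using grad_apply[of f "x + s *\<^sub>R h" h] assms(3,7) seg[OF that]
    by (cases p) (auto simp: \<phi>_def)
  obtain q where p: "p = Suc q"
    using assms(3) by (cases p) auto
  note tr = beta_max_trade_off[OF assms(3) _ assms(12-14)]
  have \<gamma>: "\<sigma> / L > 0"
    using assms(8,10) by simp
  note \<beta>1 = tr(1)[OF \<gamma>]
  have "(1 + \<alpha>) * L * \<beta> ^ p / fact p \<le> \<sigma> * (1 - \<beta>) ^ p"
    using tr(2)[OF \<gamma>] assms(8) by (simp add: field_simps)
  then have gain: "(1 + \<alpha>) * L * \<beta> ^ p / fact p * (t ^ p * r ^ (p + 1))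
      \<le> \<sigma> * (1 - \<beta>) ^ p * (t ^ p * r ^ (p + 1))" if "0 \<le> t" for t
    using r that by (intro mult_right_mono) auto

  have taylor: "\<phi> 1 0 + (\<Sum>k=2..p. s ^ (k - 1) / fact (k - 1) * \<phi> k 0)
      - L * r ^ (p + 1) * (s ^ p / fact p) \<le> \<phi> 1 s" if "0 \<le> s" "s \<le> 1" for s
  proof -
    \<comment> \<open>The Lipschitz bound is used in the order \<open>x\<close>, \<open>x + s h\<close>, whose difference is \<open>-s h\<close>.\<close>
    have "\<phi> p 0 - L * r ^ (p + 1) * s \<le> \<phi> p s" if "0 \<le> s" "s \<le> 1" for s
      using lipschitz_pth_deriv_diagonal[OF pd assms(4) assms(15) seg[OF that] assms(7,9), of h]
        Bnorm_scaleR[of B "- s" h] that(1)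
      by (simp add: \<phi>_def r_def algebra_simps)
    then have "(\<Sum>k\<le>q. s ^ k / fact k * \<phi> (Suc k) 0)
        - L * r ^ (p + 1) * (s ^ Suc q / fact (Suc q)) \<le> \<phi> (Suc 0) s"
      using deriv p that by (intro Taylor_lower_bound[of q "\<lambda>k. \<phi> (Suc k)"]) auto
    moreover have "(\<Sum>k\<le>q. s ^ k / fact k * \<phi> (Suc k) 0)
        = \<phi> 1 0 + (\<Sum>k=2..p. s ^ (k - 1) / fact (k - 1) * \<phi> k 0)"
    proof -
      have "(\<Sum>k\<le>q. s ^ k / fact k * \<phi> (Suc k) 0) = (\<Sum>k=1..p. s ^ (k - 1) / fact (k - 1) * \<phi> k 0)"
        unfolding p One_nat_def sum.shift_bounds_cl_Suc_ivl by (simp add: atLeast0AtMost)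
      also have "\<dots> = \<phi> 1 0 + (\<Sum>k=2..p. s ^ (k - 1) / fact (k - 1) * \<phi> k 0)"
        using assms(3) by (simp add: sum.atLeast_Suc_atMost numeral_2_eq_2)
      finally show ?thesis .
    qed
    ultimately show ?thesis by (simp add: p)
  qed

  \<comment> \<open>Uniform convexity between \<open>x + \<beta> t h\<close> and \<open>x + t h\<close>, divided by
    \<open>c = (1 - \<beta>) t\<close>, which vanishes at \<open>t = 0\<close>.\<close>
  have growth: "\<sigma> * (1 - \<beta>) ^ p * (t ^ p * r ^ (p + 1)) \<le> \<phi> 1 t - \<phi> 1 (\<beta> * t)"
    if t: "0 \<le> t" "t \<le> 1" for t
  proof (cases "t = 0")
    case True
    then show ?thesis using p by simp
  next
    case False
    define c where "c = (1 - \<beta>) * t"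
    have c: "c > 0"
      using False t \<beta>1 by (simp add: c_def)
    have bt: "0 \<le> \<beta> * t" "\<beta> * t \<le> 1"
      using assms(13) \<beta>1 t by (auto intro: mult_le_one)
    have ch: "(x + t *\<^sub>R h) - (x + (\<beta> * t) *\<^sub>R h) = c *\<^sub>R h"
      by (simp add: c_def algebra_simps)
    have "\<sigma> * Bnorm B (c *\<^sub>R h) ^ (p + 1)
        \<le> blinfun_apply (grad f (x + t *\<^sub>R h) - grad f (x + (\<beta> * t) *\<^sub>R h)) (c *\<^sub>R h)"
      using assms(11) seg[OF t] seg[OF bt] unfolding uniformly_convex_on_def ch[symmetric] by blast
    also have "\<dots> = c * (\<phi> 1 t - \<phi> 1 (\<beta> * t))"
      by (simp add: blinfun.diff_left blinfun.scaleR_right grad[OF t] grad[OF bt] algebra_simps)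
    finally have "c * (\<sigma> * c ^ p * r ^ (p + 1)) \<le> c * (\<phi> 1 t - \<phi> 1 (\<beta> * t))"
      using c by (simp add: Bnorm_scaleR r_def power_mult_distrib mult_ac)
    then have "\<sigma> * c ^ p * r ^ (p + 1) \<le> \<phi> 1 t - \<phi> 1 (\<beta> * t)"
      using c by simp
    then show ?thesis
      by (simp add: c_def power_mult_distrib mult_ac)
  qed

  have main: "\<phi> 1 0 + (\<Sum>k=2..p. \<beta> ^ (k - 1) * (t ^ (k - 1) / fact (k - 1)) * \<phi> k 0)
      + \<alpha> * L * \<beta> ^ p * r ^ (p + 1) * (t ^ p / fact p) \<le> \<phi> 1 t" if t: "0 \<le> t" "t \<le> 1" for t
  proof -
    have bt: "0 \<le> \<beta> * t" "\<beta> * t \<le> 1"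
      using assms(13) \<beta>1 t by (auto intro: mult_le_one)
    have "(1 + \<alpha>) * L * \<beta> ^ p / fact p * (t ^ p * r ^ (p + 1))
        = L * r ^ (p + 1) * ((\<beta> * t) ^ p / fact p) + \<alpha> * L * \<beta> ^ p * r ^ (p + 1) * (t ^ p / fact p)"
      by (simp add: power_mult_distrib field_simps)
    moreover have "(\<Sum>k=2..p. \<beta> ^ (k - 1) * (t ^ (k - 1) / fact (k - 1)) * \<phi> k 0)
        = (\<Sum>k=2..p. (\<beta> * t) ^ (k - 1) / fact (k - 1) * \<phi> k 0)"
      by (simp add: power_mult_distrib)
    ultimately show ?thesis
      using taylor[OF bt] growth[OF t] gain[OF t(1)] by linarith
  qed

  have gx: "blinfun_apply (grad f x) h = \<phi> 1 0" and gy: "blinfun_apply (grad f y) h = \<phi> 1 1"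
    using grad[of 0] grad[of 1] by (auto simp: h_def)
  have fx: "f x = \<phi> 0 0" and fy: "f y = \<phi> 0 1"
    by (auto simp: \<phi>_def h_def)
  have Dx: "Dk f x (replicate k h) = \<phi> k 0" for k
    by (simp add: \<phi>_def)
  have first: "(\<Sum>k=2..p. \<beta> ^ (k - 1) / fact (k - 1) * \<phi> k 0)
      + \<alpha> * L * \<beta> ^ p / fact p * r ^ (p + 1) \<le> \<phi> 1 1 - \<phi> 1 0"
    using main[of 1] by simp

  \<comment> \<open>\<open>?u\<close> is the antiderivative of the left-hand side of \<open>main\<close> that agrees with \<open>\<phi> 0\<close> at \<open>0\<close>.\<close>
  let ?u = "\<lambda>t. \<phi> 0 0 + t * \<phi> 1 0 + (\<Sum>k=2..p. \<beta> ^ (k - 1) * (t ^ k / fact k) * \<phi> k 0)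
      + \<alpha> * L * \<beta> ^ p * r ^ (p + 1) * (t ^ Suc p / fact (Suc p))"
  have "?u 1 \<le> \<phi> 0 1"
  proof (rule le_if_deriv_le[where u = ?u and v = "\<phi> 0"])
    fix t :: real
    assume t: "0 \<le> t" "t \<le> 1"
    have monomial: "((\<lambda>t. t ^ k / fact k) has_real_derivative t ^ (k - 1) / fact (k - 1)) (at t)"
      if "k \<in> {2..p}" for k
      using power_div_fact_deriv[of "k - 1" t] that by (simp del: fact_Suc power_Suc)
    show "(?u has_real_derivative 0 + 1 * \<phi> 1 0
        + (\<Sum>k=2..p. \<beta> ^ (k - 1) * (t ^ (k - 1) / fact (k - 1)) * \<phi> k 0)
        + \<alpha> * L * \<beta> ^ p * r ^ (p + 1) * (t ^ p / fact p)) (at t)"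
      by (intro DERIV_add DERIV_const DERIV_sum DERIV_cmult DERIV_cmult_right DERIV_ident
          monomial power_div_fact_deriv)
    show "(\<phi> 0 has_real_derivative \<phi> 1 t) (at t)"
      using deriv[of 0 t] p t by simp
    show "0 + 1 * \<phi> 1 0 + (\<Sum>k=2..p. \<beta> ^ (k - 1) * (t ^ (k - 1) / fact (k - 1)) * \<phi> k 0)
        + \<alpha> * L * \<beta> ^ p * r ^ (p + 1) * (t ^ p / fact p) \<le> \<phi> 1 t"
      using main[OF t] by simp
  qed (auto simp: sum.neutral)
  then have second: "\<phi> 0 0 + \<phi> 1 0 + (\<Sum>k=2..p. \<beta> ^ (k - 1) / fact k * \<phi> k 0)
      + \<alpha> * L * \<beta> ^ p / fact (p + 1) * r ^ (p + 1) \<le> \<phi> 0 1"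
    by simp

  show ?thesis
    using first second unfolding h_def[symmetric] r_def[symmetric] Dx fx fy
    by (simp add: blinfun.diff_left gx gy)
qed

end
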